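(* Consider four particles of mass $1$ in $\mathbb{R}^2$ moving according to $\ddot q_i=\partial U/\partial q_i$, $i=1,2,3,4$, with the Manev potential $U(q_1,\dots,q_4)=\sum_{1\le i<j\le 4}\left(\frac{1}{\|q_i-q_j\|}+\frac{1}{\|q_i-q_j\|^2}\right)$. Let $z_0=(1,0,0,1,-1,0,0,-1)^T\in\mathbb{R}^8$ be the vertices of the square inscribed in the unit circle, and let $\omega>0$ be the angular velocity for which the uniform rotation of $z_0$ about the origin is a solution, namely $\omega^2=\frac{3+\sqrt2}{2}$. Then the corresponding relative equilibrium is (linearly) unstable: the linearized system at it has an eigenvalue with positive real part.
   Context: A configuration $z=(a_1,\dots,a_n)\in(\mathbb{R}^2)^n$ together with $\omega>0$ defines a relative equilibrium if $q_i(t)=\exp(-\omega Jt)a_i$, where $J=\begin{pmatrix}0&1\\-1&0\end{pmatrix}$ and hence $\exp(-\omega Jt)=\begin{pmatrix}\cos\omega t&-\sin\omega t\\ \sin\omega t&\cos\omega t\end{pmatrix}$, solves the equations of motion. In the rotating coordinates $q_i=\exp(-\omega Jt)x_i$ the equations become $\ddot x_i=2\omega J\dot x_i+\omega^2x_i+\nabla_{x_i}U$ (unit masses), and the relative equilibrium becomes the equilibrium $x=z$. The linearized system at it is $\ddot X=2\omega\mathbf{J}\dot X+\omega^2X+D^2U(z)X$ for $X\in\mathbb{R}^{2n}$, where $\mathbf{J}=\mathrm{diag}(J,\dots,J)$ ($n$ blocks) and $D^2U(z)$ is the Hessian of $U$ at $z$. Its eigenvalues are those of the $4n\times4n$ matrix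 $\begin{pmatrix}0&I_{2n}\\ \omega^2I_{2n}+D^2U(z)&2\omega\mathbf{J}\end{pmatrix}$. The relative equilibrium is called (linearly) unstable if this matrix has an eigenvalue with positive real part. *)

theory Defs
  imports "HOL-Analysis.Analysis"
begin

text \<open>
  The state of \<open>n\<close> planar particles is a vector in \<open>\<real>\<^sup>2\<^sup>n\<close>, indexed by pairs
  (particle, coordinate); \<open>'n\<close> is the set of particles and all masses are 1.
\<close>

type_synonym 'n config = "real ^ ('n \<times> 2)"

definition pos :: "'n::finite config \<Rightarrow> 'n \<Rightarrow> real ^ 2" where
  "pos x i = (\<chi> k. x $ (i, k))"

definition config_of :: "real ^ 2 ^ 'n::finite \<Rightarrow> 'n config" where
  "config_of a = (\<chi> p. a $ fst p $ snd p)"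

text \<open>
  At collisions the terms below are 0 by the convention \<open>1 / 0 = 0\<close>, but the potential has
  no gradient there, so no solution of the equations of motion passes through a collision.
\<close>

definition manev_potential :: "'n::{finite,linorder} config \<Rightarrow> real" where
  "manev_potential x = (\<Sum>(i, j) \<in> {(i, j). i < j}.
     1 / norm (pos x i - pos x j) + 1 / (norm (pos x i - pos x j))\<^sup>2)"

definition gradient :: "('a::real_inner \<Rightarrow> real) \<Rightarrow> 'a \<Rightarrow> 'a" where
  "gradient f x = (THE D. GDERIV f x :> D)"

definition hessian :: "(real ^ 'm::finite \<Rightarrow> real) \<Rightarrow> real ^ 'm \<Rightarrow> real ^ 'm ^ 'm" where
  "hessian f x = jacobian (gradient f) (at x)"

text \<open>Equations of motion \<open>q'' = \<nabla>U(q)\<close>, for all times; \<open>v\<close> is \<open>q'\<close> and \<open>a\<close> is \<open>q''\<close>.\<close>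

definition solves_motion ::
    "('n::finite config \<Rightarrow> real) \<Rightarrow> (real \<Rightarrow> 'n config) \<Rightarrow> bool" where
  "solves_motion U q \<longleftrightarrow> (\<exists>v a. \<forall>t.
     (q has_vector_derivative v t) (at t) \<and>
     (v has_vector_derivative a t) (at t) \<and>
     GDERIV U (q t) :> a t)"

definition J :: "real ^ 2 ^ 2" where
  "J = vector [vector [0, 1], vector [-1, 0]]"

text \<open>The matrix \<open>exp (-\<theta> J)\<close>.\<close>

definition rot :: "real \<Rightarrow> real ^ 2 ^ 2" where
  "rot \<theta> = vector [vector [cos \<theta>, - sin \<theta>], vector [sin \<theta>, cos \<theta>]]"

definition relative_equilibrium ::
    "('n::finite config \<Rightarrow> real) \<Rightarrow> real \<Rightarrow> 'n config \<Rightarrow> bool" where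
  "relative_equilibrium U \<omega> z \<longleftrightarrow>
     \<omega> > 0 \<and> solves_motion U (\<lambda>t. config_of (\<chi> i. rot (\<omega> * t) *v pos z i))"

definition block_J :: "real ^ ('n::finite \<times> 2) ^ ('n \<times> 2)" where
  "block_J = (\<chi> p q. if fst p = fst q then J $ snd p $ snd q else 0)"

definition block_matrix ::
    "'a ^ 'm::finite ^ 'm \<Rightarrow> 'a ^ 'm ^ 'm \<Rightarrow> 'a ^ 'm ^ 'm \<Rightarrow> 'a ^ 'm ^ 'm \<Rightarrow>
      'a ^ ('m + 'm) ^ ('m + 'm)" where
  "block_matrix A B C D = (\<chi> r c.
     (case r of
        Inl i \<Rightarrow> (case c of Inl j \<Rightarrow> A $ i $ j | Inr j \<Rightarrow> B $ i $ j)
      | Inr i \<Rightarrow> (case c of Inl j \<Rightarrow> C $ i $ j | Inr j \<Rightarrow> D $ i $ j)))"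

text \<open>
  The system \<open>X'' = 2 \<omega> block_J X' + \<omega>\<^sup>2 X + D\<^sup>2U(z) X\<close>, linearized in rotating
  coordinates, written as a first-order system in \<open>(X, X')\<close>.
\<close>

definition linearization_matrix ::
    "('n::finite config \<Rightarrow> real) \<Rightarrow> real \<Rightarrow> 'n config \<Rightarrow>
      real ^ (('n \<times> 2) + ('n \<times> 2)) ^ (('n \<times> 2) + ('n \<times> 2))" where
  "linearization_matrix U \<omega> z =
     block_matrix 0 (mat 1) (\<omega>\<^sup>2 *\<^sub>R mat 1 + hessian U z) ((2 * \<omega>) *\<^sub>R block_J)"

definition eigenvalue :: "complex ^ 'm::finite ^ 'm \<Rightarrow> complex \<Rightarrow> bool" where
  "eigenvalue A \<mu> \<longleftrightarrow> (\<exists>v. v \<noteq> 0 \<and> A *v v = \<mu> *s v)"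

definition linearly_unstable ::
    "('n::finite config \<Rightarrow> real) \<Rightarrow> real \<Rightarrow> 'n config \<Rightarrow> bool" where
  "linearly_unstable U \<omega> z \<longleftrightarrow>
     (\<exists>\<mu>. eigenvalue (map_matrix complex_of_real (linearization_matrix U \<omega> z)) \<mu> \<and> Re \<mu> > 0)"

definition square_config :: "4 config" where
  "square_config = config_of
     (vector [vector [1, 0], vector [0, 1], vector [-1, 0], vector [0, -1]])"

end

theory Submission
  imports Defs
begin

text \<open>
  Instability comes from the displacements that attach \<open>(-R)\<^sup>j (a, b)\<close> to the \<open>j\<close>-th vertex
  (counted from 0), where \<open>R\<close> is the rotation by \<open>\<pi> / 2\<close>. By symmetry both the Hessian and \<open>block_J\<close> preserve this plane,
  on which the linearized system reads \<open>a'' = k a + 2 \<omega> b'\<close>, \<open>b'' = l b - 2 \<omega> a'\<close> with \<open>k = 7/4\<close> and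
  \<open>l = 4 + 3 sqrt 2 / 2\<close>. Its characteristic polynomial \<open>\<mu>^4 + (4 \<omega>^2 - k - l) \<mu>^2 + k l\<close> has negative
  discriminant in \<open>\<mu>^2\<close>, so \<open>\<mu>^2\<close> is not real and one of its square roots has positive real part.
\<close>

section \<open>Configurations and the positions of their particles\<close>

lemma pos_config_of [simp]: "pos (config_of a) i = a $ i"
  by (simp add: pos_def config_of_def vec_eq_iff)

lemma config_of_pos [simp]: "config_of (\<chi> i. pos x i) = x"
  by (simp add: pos_def config_of_def vec_eq_iff)

lemma pos_nth [simp]: "pos x i $ k = x $ (i, k)"
  by (simp add: pos_def)

lemma config_of_nth [simp]: "config_of a $ p = a $ fst p $ snd p"
  by (simp add: config_of_def)

lemma config_eqI: "(\<And>i. pos x i = pos y i) \<Longrightarrow> x = y"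
  by (simp add: pos_def vec_eq_iff)

lemma pos_algebra [simp]:
  "pos (x + y) i = pos x i + pos y i"
  "pos (x - y) i = pos x i - pos y i"
  "pos (c *\<^sub>R x) i = c *\<^sub>R pos x i"
  by (simp_all add: pos_def vec_eq_iff)

lemma bounded_linear_pos: "bounded_linear (\<lambda>x. pos x i)"
  by (simp add: linear_conv_bounded_linear[symmetric] linear_iff)

lemma inner_config_of: "inner h (config_of a) = (\<Sum>i\<in>UNIV. inner (pos h i) (a $ i))"
proof -
  have "inner h (config_of a) = (\<Sum>(i, k)\<in>UNIV \<times> UNIV. h $ (i, k) * a $ i $ k)"
    by (simp add: inner_vec_def case_prod_unfold)
  then show ?thesis
    by (simp add: sum.cartesian_product inner_vec_def pos_def)
qed

section \<open>Gradients and sums over pairs\<close>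

lemma GDERIV_unique:
  assumes "GDERIV f x :> D" and "GDERIV f x :> E"
  shows "D = E"
proof -
  have "(\<lambda>h. inner h D) = (\<lambda>h. inner h E)"
    using assms unfolding gderiv_def by (rule has_derivative_unique)
  then have "inner (D - E) (D - E) = 0"
    by (metis inner_diff_right right_minus_eq)
  then show ?thesis by simp
qed

lemma gradient_eqI: "GDERIV f x :> D \<Longrightarrow> gradient f x = D"
  unfolding gradient_def using GDERIV_unique by blast

text \<open>A pair \<open>i < j\<close> acts on both of its members, and the ordered pairs
  \<open>(i, j)\<close> and \<open>(j, i)\<close> obtained in this way exhaust the off-diagonal
  pairs. This regroups a sum over pairs into total forces on single particles.\<close>

lemma sum_less_symmetrize:
  fixes f :: "'n::{finite,linorder} \<Rightarrow> 'n \<Rightarrow> 'b::comm_monoid_add"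
  shows "(\<Sum>(i, j)\<in>{(i, j). i < j}. f i j + f j i) = (\<Sum>i\<in>UNIV. \<Sum>j\<in>-{i}. f i j)"
proof -
  have swap: "(\<Sum>(i, j)\<in>{(i, j). i < j}. f j i) = (\<Sum>(i, j)\<in>{(i, j). j < i}. f i j)"
    by (rule sum.reindex_bij_witness[of _ prod.swap prod.swap]) auto
  have "(\<Sum>(i, j)\<in>{(i, j). i < j}. f i j + f j i) =
      (\<Sum>(i, j)\<in>{(i, j). i < j}. f i j) + (\<Sum>(i, j)\<in>{(i, j). j < i}. f i j)"
    by (simp add: case_prod_unfold sum.distrib swap[unfolded case_prod_unfold])
  also have "\<dots> = (\<Sum>(i, j)\<in>{(i, j). i < j} \<union> {(i, j). j < i}. f i j)"
    by (rule sum.union_disjoint[symmetric]) auto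
  also have "{(i, j). i < j} \<union> {(i, j). j < i} = Sigma UNIV (\<lambda>i::'n. -{i})"
    by auto
  finally show ?thesis
    by (simp add: sum.Sigma)
qed

section \<open>The force within a pair and its derivative\<close>

definition pair_force :: "'a::real_inner \<Rightarrow> 'a" where
  "pair_force d = - (1 / norm d ^ 3 + 2 / norm d ^ 4) *\<^sub>R d"

definition pair_force_deriv :: "'a::real_inner \<Rightarrow> 'a \<Rightarrow> 'a" where
  "pair_force_deriv d h =
     (3 / norm d ^ 5 + 8 / norm d ^ 6) *\<^sub>R inner d h *\<^sub>R d
     - (1 / norm d ^ 3 + 2 / norm d ^ 4) *\<^sub>R h"

lemma pair_force_minus: "pair_force (- d) = - pair_force d"
  by (simp add: pair_force_def)

text \<open>The chain rule through the norm gives the radial derivative times \<open>sgn d\<close>;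
  the factor \<open>1 / norm d\<close> in \<open>sgn d\<close> raises each exponent by one.\<close>

lemma GDERIV_pair_potential:
  assumes "d \<noteq> 0"
  shows "GDERIV (\<lambda>d. 1 / norm d + 1 / (norm d)\<^sup>2) d :> pair_force d"
proof -
  let ?r = "norm d"
  have r: "?r \<noteq> 0" using assms by simp
  have "DERIV (\<lambda>r. 1 / r + 1 / r\<^sup>2) ?r :> - 1 / ?r ^ 2 - 2 / ?r ^ 3"
    using r by (auto intro!: derivative_eq_intros simp: field_simps power2_eq_square power3_eq_cube)
  from GDERIV_DERIV_compose[OF GDERIV_norm[OF assms] this]
  have "GDERIV (\<lambda>d. 1 / norm d + 1 / (norm d)\<^sup>2) d :> (- 1 / ?r ^ 2 - 2 / ?r ^ 3) *\<^sub>R sgn d"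
    by simp
  moreover have "(- 1 / ?r ^ 2 - 2 / ?r ^ 3) / ?r = - (1 / ?r ^ 3 + 2 / ?r ^ 4)"
    using r by (simp add: field_simps eval_nat_numeral)
  then have "(- 1 / ?r ^ 2 - 2 / ?r ^ 3) *\<^sub>R sgn d = pair_force d"
    by (simp only: pair_force_def sgn_div_norm scaleR_scaleR divide_inverse)
  ultimately show ?thesis by simp
qed

text \<open>Product rule for a radial scalar factor times \<open>d\<close>. Differentiating the
  factor yields the rank-one term along \<open>d\<close>, and the factor itself yields the multiple
  of \<open>h\<close>.\<close>

lemma has_derivative_pair_force:
  assumes "d \<noteq> 0"
  shows "(pair_force has_derivative pair_force_deriv d) (at d)"
proof -
  let ?r = "norm d"
  have r: "?r \<noteq> 0" using assms by simp
  have "DERIV (\<lambda>r. - (1 / r ^ 3 + 2 / r ^ 4)) ?r :> 3 / ?r ^ 4 + 8 / ?r ^ 5"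
    using r by (auto intro!: derivative_eq_intros simp: field_simps eval_nat_numeral)
  from GDERIV_DERIV_compose[OF GDERIV_norm[OF assms] this]
  have "((\<lambda>d. - (1 / norm d ^ 3 + 2 / norm d ^ 4)) has_derivative
      (\<lambda>h. inner h ((3 / ?r ^ 4 + 8 / ?r ^ 5) *\<^sub>R sgn d))) (at d)"
    by (simp add: gderiv_def)
  from has_derivative_scaleR[OF this has_derivative_ident]
  have "(pair_force has_derivative (\<lambda>h. - (1 / ?r ^ 3 + 2 / ?r ^ 4) *\<^sub>R h +
      inner h ((3 / ?r ^ 4 + 8 / ?r ^ 5) *\<^sub>R sgn d) *\<^sub>R d)) (at d)"
    by (simp add: pair_force_def[abs_def])
  moreover have "(3 / ?r ^ 4 + 8 / ?r ^ 5) / ?r = 3 / ?r ^ 5 + 8 / ?r ^ 6"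
    using r by (simp add: field_simps eval_nat_numeral)
  then have "inner h ((3 / ?r ^ 4 + 8 / ?r ^ 5) *\<^sub>R sgn d) *\<^sub>R d =
      (3 / ?r ^ 5 + 8 / ?r ^ 6) *\<^sub>R inner d h *\<^sub>R d" for h
    by (simp add: sgn_div_norm inner_commute mult.commute divide_inverse)
  ultimately show ?thesis
    by (simp only: pair_force_deriv_def[abs_def] scaleR_minus_left uminus_add_conv_diff)
qed

section \<open>Gradient and Hessian of the Manev potential\<close>

definition manev_force :: "'n::finite config \<Rightarrow> 'n config" where
  "manev_force x = config_of (\<chi> i. \<Sum>j\<in>-{i}. pair_force (pos x i - pos x j))"

text \<open>\<open>inj (pos x)\<close> excludes collisions, so every pair term is differentiable.
  Since \<open>pair_force\<close> is odd (action equals reaction), the sum over pairs regroups into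
  forces on particles.\<close>

lemma GDERIV_manev_potential:
  fixes x :: "'n::{finite,linorder} config"
  assumes "inj (pos x)"
  shows "GDERIV manev_potential x :> manev_force x"
proof -
  let ?F = "\<lambda>i j. pair_force (pos x i - pos x j)"
  have "((\<lambda>y. case p of (i, j) \<Rightarrow>
        1 / norm (pos y i - pos y j) + 1 / (norm (pos y i - pos y j))\<^sup>2)
      has_derivative (\<lambda>h. case p of (i, j) \<Rightarrow> inner (pos h i - pos h j) (?F i j))) (at x)"
    if "p \<in> {(i, j). i < j}" for p
  proof -
    obtain i j where p: "p = (i, j)" and "i < j" using \<open>p \<in> _\<close> by auto
    then have "pos x i - pos x j \<noteq> 0" using assms by (auto dest: injD)
    note D = GDERIV_pair_potential[OF this, unfolded gderiv_def]
    have L: "((\<lambda>y. pos y i - pos y j) has_derivative (\<lambda>h. pos h i - pos h j)) (at x)"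
      by (intro bounded_linear_imp_has_derivative bounded_linear_sub bounded_linear_pos)
    show ?thesis
      using has_derivative_compose[OF L D] by (simp add: p)
  qed
  then have "(manev_potential has_derivative
      (\<lambda>h. \<Sum>(i, j)\<in>{(i, j). i < j}. inner (pos h i - pos h j) (?F i j))) (at x)"
    unfolding manev_potential_def[abs_def] by (rule has_derivative_sum)
  moreover have "(\<Sum>(i, j)\<in>{(i, j). i < j}. inner (pos h i - pos h j) (?F i j)) =
      inner h (manev_force x)" for h
  proof -
    have "inner (pos h i - pos h j) (?F i j) =
        inner (pos h i) (?F i j) + inner (pos h j) (?F j i)" for i j
      using pair_force_minus[of "pos x i - pos x j"] by (simp add: inner_diff_left)
    then show ?thesis
      by (simp add: manev_force_def inner_config_of inner_sum_right
          sum_less_symmetrize[of "\<lambda>i j. inner (pos h i) (?F i j)"])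
  qed
  ultimately show ?thesis
    by (simp add: gderiv_def)
qed

lemma has_derivative_manev_force:
  fixes x :: "'n::finite config"
  assumes "inj (pos x)"
  shows "(manev_force has_derivative
    (\<lambda>h. config_of (\<chi> i. \<Sum>j\<in>-{i}. pair_force_deriv (pos x i - pos x j) (pos h i - pos h j))))
    (at x)"
proof -
  have pair: "((\<lambda>y. pair_force (pos y i - pos y j)) has_derivative
      (\<lambda>h. pair_force_deriv (pos x i - pos x j) (pos h i - pos h j))) (at x)"
    if "j \<in> -{i}" for i j
  proof -
    have "pos x i - pos x j \<noteq> 0" using assms that by (auto dest: injD)
    note D = has_derivative_pair_force[OF this]
    have L: "((\<lambda>y. pos y i - pos y j) has_derivative (\<lambda>h. pos h i - pos h j)) (at x)"
      by (intro bounded_linear_imp_has_derivative bounded_linear_sub bounded_linear_pos)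
    show ?thesis
      using has_derivative_compose[OF L D] .
  qed
  have comp: "((\<lambda>y. (\<Sum>j\<in>-{i}. pair_force (pos y i - pos y j)) $ k) has_derivative
      (\<lambda>h. (\<Sum>j\<in>-{i}. pair_force_deriv (pos x i - pos x j) (pos h i - pos h j)) $ k)) (at x)"
    for i k
    by (intro bounded_linear.has_derivative[OF bounded_linear_vec_nth] has_derivative_sum pair)
  show ?thesis
    by (subst has_derivative_componentwise_within)
      (auto simp: Basis_vec_def inner_axis manev_force_def comp simp del: sum_component)
qed

text \<open>\<open>gradient manev_potential\<close> is identified with \<open>manev_force\<close>
  only away from collisions; openness of this region lets the derivative pass from one to the
  other.\<close>

lemma open_inj_pos: "open {x :: 'n::finite config. inj (pos x)}"
proof -
  have "{x :: 'n config. inj (pos x)} = (\<Inter>i. \<Inter>j\<in>-{i}. {x. pos x i \<noteq> pos x j})"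
    by (auto simp: inj_def)
  moreover have "open {x :: 'n config. pos x i \<noteq> pos x j}" for i j
    by (intro open_Collect_neq linear_continuous_on bounded_linear_pos)
  ultimately show ?thesis by (simp add: open_INT)
qed

lemma hessian_manev_potential:
  fixes x :: "'n::{finite,linorder} config"
  assumes "inj (pos x)"
  shows "hessian manev_potential x *v h =
    config_of (\<chi> i. \<Sum>j\<in>-{i}. pair_force_deriv (pos x i - pos x j) (pos h i - pos h j))"
proof -
  have "(gradient manev_potential has_derivative
    (\<lambda>h. config_of (\<chi> i. \<Sum>j\<in>-{i}. pair_force_deriv (pos x i - pos x j) (pos h i - pos h j))))
    (at x)" (is "(_ has_derivative ?D) _")
    using has_derivative_manev_force[OF assms] open_inj_pos
    by (rule has_derivative_transform_within_open)
      (use assms in \<open>auto simp: gradient_eqI[OF GDERIV_manev_potential]\<close>)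
  \<comment> \<open>A Jacobian matrix represents the derivative once differentiability is known,
    which \<open>?D\<close> witnesses; uniqueness then equates the two.\<close>
  then have "(gradient manev_potential has_derivative
      (\<lambda>h. hessian manev_potential x *v h)) (at x)"
    unfolding hessian_def using jacobian_works differentiable_def by blast
  then have "(\<lambda>h. hessian manev_potential x *v h) = ?D"
    using \<open>(_ has_derivative ?D) _\<close> by (rule has_derivative_unique)
  then show ?thesis by (rule fun_cong)
qed

section \<open>Rotational equivariance and relative equilibria\<close>

lemma pair_force_isometry:
  fixes A :: "real ^ 'm ^ 'm"
  assumes "\<And>d. norm (A *v d) = norm d"
  shows "pair_force (A *v d) = A *v pair_force d"
  by (simp add: pair_force_def assms matrix_vector_mult_scaleR)

text \<open>Each pair force is the difference vector times a function of its length, hence commutes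
  with linear isometries; linearity carries this over to the sums.\<close>

lemma manev_force_isometry:
  assumes "\<And>d. norm (A *v d) = norm d"
  shows "manev_force (config_of (\<chi> i. A *v pos z i)) = config_of (\<chi> i. A *v pos (manev_force z) i)"
proof -
  have "A *v (\<Sum>j\<in>S. f j) = (\<Sum>j\<in>S. A *v f j)" for S :: "'a set" and f
    by (rule linear_sum) simp
  then show ?thesis
    by (simp add: manev_force_def pair_force_isometry[OF assms]
        flip: matrix_vector_mult_diff_distrib)
qed

lemma rot_mult_vec:
  "(rot \<theta> *v d) $ 1 = cos \<theta> * d $ 1 - sin \<theta> * d $ 2"
  "(rot \<theta> *v d) $ 2 = sin \<theta> * d $ 1 + cos \<theta> * d $ 2"
  by (simp_all add: rot_def matrix_vector_mult_def sum_2)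

lemma norm_rot [simp]: "norm (rot \<theta> *v d) = norm d"
proof -
  have "(cos \<theta> * a - sin \<theta> * b)\<^sup>2 + (sin \<theta> * a + cos \<theta> * b)\<^sup>2 =
      (sin \<theta> ^ 2 + cos \<theta> ^ 2) * (a\<^sup>2 + b\<^sup>2)" for a b
    by algebra
  then show ?thesis
    by (simp add: norm_vec_def L2_set_def sum_2 rot_mult_vec)
qed

text \<open>Separates time from space: a rotating configuration is a combination of two fixed
  vectors with coefficients \<open>cos\<close> and \<open>sin\<close>, which is easy to
  differentiate.\<close>

lemma rot_decompose: "rot \<theta> *v d = cos \<theta> *\<^sub>R d + sin \<theta> *\<^sub>R (rot (pi / 2) *v d)"
  by (simp add: vec_eq_iff forall_2 rot_mult_vec)

text \<open>Uniform rotation has acceleration \<open>- \<omega>\<^sup>2\<close> times the position.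
  At time 0 the equation of motion is thus the condition for a central configuration, and
  equivariance of the force spreads it to all times.\<close>

lemma relative_equilibrium_manev_iff:
  fixes z :: "'n::{finite,linorder} config"
  assumes "inj (pos z)" and "\<omega> > 0"
  shows "relative_equilibrium manev_potential \<omega> z \<longleftrightarrow> manev_force z = - (\<omega>\<^sup>2 *\<^sub>R z)"
proof -
  define q where "q t = config_of (\<chi> i. rot (\<omega> * t) *v pos z i)" for t
  define w where "w = config_of (\<chi> i. rot (pi / 2) *v pos z i)"
  define v where "v t = \<omega> *\<^sub>R (cos (\<omega> * t) *\<^sub>R w - sin (\<omega> * t) *\<^sub>R z)" for t
  have q_eq: "q t = cos (\<omega> * t) *\<^sub>R z + sin (\<omega> * t) *\<^sub>R w" for t
    unfolding q_def w_def
    by (rule config_eqI) (simp add: rot_decompose[of "\<omega> * t"])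
  have q0: "q 0 = z" by (simp add: q_eq)
  have dq: "(q has_vector_derivative v t) (at t)" for t
    unfolding q_eq[abs_def] v_def
    by (auto intro!: derivative_eq_intros simp: algebra_simps)
  have dv: "(v has_vector_derivative - (\<omega>\<^sup>2 *\<^sub>R q t)) (at t)" for t
    unfolding q_eq v_def[abs_def]
    by (auto intro!: derivative_eq_intros simp: algebra_simps power2_eq_square)
  have "norm (pos (q t) i - pos (q t) j) = norm (pos z i - pos z j)" for t i j
    by (simp add: q_def flip: matrix_vector_mult_diff_distrib)
  then have inj: "inj (pos (q t))" for t
    using assms(1) by (metis (no_types, lifting) injD injI norm_eq_zero right_minus_eq)
  have iff: "relative_equilibrium manev_potential \<omega> z \<longleftrightarrow> solves_motion manev_potential q"
    using assms(2) by (simp add: relative_equilibrium_def q_def[abs_def])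
  show ?thesis
  proof
    assume "relative_equilibrium manev_potential \<omega> z"
    then obtain v' a where
      v': "\<And>t. (q has_vector_derivative v' t) (at t)" and
      a: "\<And>t. (v' has_vector_derivative a t) (at t)" and
      g: "\<And>t. GDERIV manev_potential (q t) :> a t"
      unfolding iff solves_motion_def by blast
    \<comment> \<open>The curve determines its velocity and acceleration, so the witnesses from
      \<open>solves_motion\<close> must be the computed ones.\<close>
    have "v' = v" using v' dq by (blast intro: vector_derivative_unique_at)
    then have "a 0 = - (\<omega>\<^sup>2 *\<^sub>R z)"
      using a[of 0] dv[of 0] vector_derivative_unique_at q0 by metis
    moreover have "a 0 = manev_force z"
      using g[of 0] GDERIV_manev_potential[OF assms(1)] q0 GDERIV_unique by metis
    ultimately show "manev_force z = - (\<omega>\<^sup>2 *\<^sub>R z)" by simp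
  next
    assume eq: "manev_force z = - (\<omega>\<^sup>2 *\<^sub>R z)"
    have "manev_force (q t) = - (\<omega>\<^sup>2 *\<^sub>R q t)" for t
    proof (rule config_eqI)
      show "pos (manev_force (q t)) i = pos (- (\<omega>\<^sup>2 *\<^sub>R q t)) i" for i
        using eq unfolding q_def manev_force_isometry[OF norm_rot]
        by (simp add: matrix_vector_mult_scaleR flip: scaleR_minus_left)
    qed
    then have "GDERIV manev_potential (q t) :> - (\<omega>\<^sup>2 *\<^sub>R q t)" for t
      using GDERIV_manev_potential[OF inj] by metis
    then show "relative_equilibrium manev_potential \<omega> z"
      unfolding iff solves_motion_def using dq dv
      by (intro exI[of _ v] exI[of _ "\<lambda>t. - (\<omega>\<^sup>2 *\<^sub>R q t)"]) simp
  qed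
qed

section \<open>Eigenvalues of the linearization and roots of a biquadratic\<close>

lemma eigenvalue_linearization_matrixI:
  fixes X :: "complex ^ ('n::finite \<times> 2)"
  assumes "X \<noteq> 0"
    and eq: "\<mu>\<^sup>2 *s X = of_real (\<omega>\<^sup>2) *s X + map_matrix of_real (hessian U z) *v X
      + (2 * of_real \<omega> * \<mu>) *s (map_matrix of_real block_J *v X)"
  shows "eigenvalue (map_matrix complex_of_real (linearization_matrix U \<omega> z)) \<mu>"
proof -
  \<comment> \<open>The eigenvector is the pair \<open>(X, \<mu> X)\<close>: the upper block row
    then holds by construction, and the lower one is \<open>eq\<close>.\<close>
  define Y :: "complex ^ (('n \<times> 2) + ('n \<times> 2))"
    where "Y = (\<chi> r. case r of Inl p \<Rightarrow> X $ p | Inr p \<Rightarrow> \<mu> * X $ p)"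
  let ?A = "map_matrix complex_of_real (linearization_matrix U \<omega> z)"
  obtain p where "X $ p \<noteq> 0" using assms(1) by (auto simp: vec_eq_iff)
  then have "Y $ Inl p \<noteq> 0" by (simp add: Y_def)
  then have "Y \<noteq> 0" by (metis zero_index)
  have sum_Plus: "sum f UNIV = (\<Sum>p\<in>UNIV. f (Inl p)) + (\<Sum>p\<in>UNIV. f (Inr p))"
    for f :: "('n \<times> 2) + ('n \<times> 2) \<Rightarrow> complex"
    by (simp add: sum.Plus flip: UNIV_Plus_UNIV)
  have Inl_entry: "linearization_matrix U \<omega> z $ Inr p $ Inl q =
      \<omega>\<^sup>2 * mat 1 $ p $ q + hessian U z $ p $ q" for p q
    by (simp add: linearization_matrix_def block_matrix_def)
  have sum_mat: "(\<Sum>q\<in>UNIV. c * of_real (mat 1 $ p $ q) * X $ q) = c * X $ p" for c p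
    by (simp add: mat_def if_distrib if_distribR cong: if_cong)
  have Inr_entry: "linearization_matrix U \<omega> z $ Inr p $ Inr q = 2 * \<omega> * block_J $ p $ q" for p q
    by (simp add: linearization_matrix_def block_matrix_def)
  have "(?A *v Y) $ r = (\<mu> *s Y) $ r" for r
  proof (cases r)
    case (Inl p)
    then show ?thesis
      by (simp add: matrix_vector_mult_def sum_Plus linearization_matrix_def block_matrix_def
          map_matrix_def Y_def mat_def if_distrib if_distribR cong: if_cong)
  next
    case (Inr p)
    have "\<mu> * (\<mu> * X $ p) = (\<mu>\<^sup>2 *s X) $ p"
      by (simp add: power2_eq_square)
    also have "\<dots> = (?A *v Y) $ Inr p"
      unfolding eq
      by (simp add: matrix_vector_mult_def map_matrix_def sum_Plus Y_def Inl_entry Inr_entry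
          distrib_right sum.distrib sum_mat sum_distrib_left)
        (simp add: mult_ac)
    finally show ?thesis by (simp add: Inr Y_def)
  qed
  with \<open>Y \<noteq> 0\<close> show ?thesis
    unfolding eigenvalue_def by (auto simp: vec_eq_iff)
qed

text \<open>Real and imaginary parts are acted on separately, so the action of the Hessian computed
  on real vectors extends to complex ones.\<close>

lemma map_matrix_of_real_mult_vec:
  "(map_matrix complex_of_real M *v X) $ p =
     Complex ((M *v (\<chi> q. Re (X $ q))) $ p) ((M *v (\<chi> q. Im (X $ q))) $ p)"
  by (simp add: complex_eq_iff matrix_vector_mult_def map_matrix_def)

lemma exists_quartic_root_Re_pos:
  fixes b c :: real
  assumes "b\<^sup>2 < 4 * c"
  shows "\<exists>\<mu>. Re \<mu> > 0 \<and> \<mu> ^ 4 + of_real b * \<mu>\<^sup>2 + of_real c = 0"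
proof -
  define u where "u = Complex (- b / 2) (sqrt (4 * c - b\<^sup>2) / 2)"
  have "(sqrt (4 * c - b\<^sup>2))\<^sup>2 = 4 * c - b\<^sup>2" using assms by simp
  then have u: "u\<^sup>2 + of_real b * u + of_real c = 0"
    by (simp add: u_def complex_eq_iff power2_eq_square field_simps)
  have sq: "(csqrt u)\<^sup>2 = u" by simp
  \<comment> \<open>The principal root has non-negative real part; were that part 0, its square
    \<open>u\<close> would be real.\<close>
  have "Im u \<noteq> 0" using assms by (simp add: u_def)
  then have "Re (csqrt u) \<noteq> 0"
    by (metis Im_power2 mult_zero_left mult_zero_right sq)
  then have "Re (csqrt u) > 0" using csqrt_principal[of u] by auto
  moreover have "csqrt u ^ 4 = u\<^sup>2"
    by (metis sq power_mult mult_2_right numeral_Bit0 power2_eq_square power_add)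
  ultimately show ?thesis using u by (metis sq)
qed

section \<open>The square and its invariant plane of displacements\<close>

lemma sum_Compl_singleton_4:
  "(\<Sum>j\<in>-{1::4}. f j) = f 2 + f 3 + f 4"
  "(\<Sum>j\<in>-{2::4}. f j) = f 1 + f 3 + f 4"
  "(\<Sum>j\<in>-{3::4}. f j) = f 1 + f 2 + f 4"
  "(\<Sum>j\<in>-{4::4}. f j) = f 1 + f 2 + f 3"
  for f :: "4 \<Rightarrow> 'b::ab_group_add"
  by (simp_all add: Compl_eq_Diff_UNIV sum_diff1 sum_4)

lemma vector_4 [simp]:
  "(vector [a, b, c, d] :: 'a::zero ^ 4) $ 1 = a"
  "(vector [a, b, c, d] :: 'a::zero ^ 4) $ 2 = b"
  "(vector [a, b, c, d] :: 'a::zero ^ 4) $ 3 = c"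
  "(vector [a, b, c, d] :: 'a::zero ^ 4) $ 4 = d"
  by (simp_all add: vector_def)

text \<open>The eigenspace for -1 of the quarter turn that also permutes the particles cyclically:
  the radial component \<open>a\<close> and the tangential component \<open>b\<close> alternate in
  sign around the square. The type is generic because the Hessian is evaluated on real modes and the
  eigenvector is a complex one.\<close>

definition mode :: "'a::ab_group_add \<Rightarrow> 'a \<Rightarrow> 'a ^ (4 \<times> 2)" where
  "mode a b = (\<chi> p. (vector [vector [a, b], vector [b, - a], vector [- a, - b], vector [- b, a]]
     :: 'a ^ 2 ^ 4) $ fst p $ snd p)"

lemma mode_nth [simp]:
  "mode a b $ (1, 1) = a" "mode a b $ (1, 2) = b"
  "mode a b $ (2, 1) = b" "mode a b $ (2, 2) = - a"
  "mode a b $ (3, 1) = - a" "mode a b $ (3, 2) = - b"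
  "mode a b $ (4, 1) = - b" "mode a b $ (4, 2) = a"
  by (simp_all add: mode_def)

lemma vec_prod_eq_iff:
  fixes X Y :: "'a ^ ('m::finite \<times> 'n::finite)"
  shows "X = Y \<longleftrightarrow> (\<forall>i k. X $ (i, k) = Y $ (i, k))"
  by (auto simp: vec_eq_iff)

lemma mode_linear:
  "c *s mode a b = mode (c * a) (c * b)"
  "mode a b + mode a' b' = mode (a + a') (b + b')"
  for a b c a' b' :: "'a::comm_ring_1"
  by (simp_all add: vec_prod_eq_iff forall_4 forall_2)

lemma mode_Re_Im:
  "Re (mode a b $ p) = mode (Re a) (Re b) $ p"
  "Im (mode a b $ p) = mode (Im a) (Im b) $ p"
proof -
  have "\<forall>i k. Re (mode a b $ (i, k)) = mode (Re a) (Re b) $ (i, k)"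
    "\<forall>i k. Im (mode a b $ (i, k)) = mode (Im a) (Im b) $ (i, k)"
    by (simp_all add: forall_4 forall_2)
  then show "Re (mode a b $ p) = mode (Re a) (Re b) $ p" "Im (mode a b $ p) = mode (Im a) (Im b) $ p"
    by (metis surj_pair)+
qed

lemma square_config_nth [simp]:
  "square_config $ (1, 1) = 1" "square_config $ (1, 2) = 0"
  "square_config $ (2, 1) = 0" "square_config $ (2, 2) = 1"
  "square_config $ (3, 1) = -1" "square_config $ (3, 2) = 0"
  "square_config $ (4, 1) = 0" "square_config $ (4, 2) = -1"
  by (simp_all add: square_config_def)

lemma inj_pos_square_config: "inj (pos square_config)"
  unfolding inj_def forall_4
  by (simp add: vec_eq_iff forall_2)

lemma norm_vec_2: "norm (x :: real ^ 2) = sqrt ((x $ 1)\<^sup>2 + (x $ 2)\<^sup>2)"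
  by (simp add: norm_vec_def L2_set_def sum_2)

lemma sqrt_2_powers: "sqrt 2 ^ 3 = 2 * sqrt 2" "sqrt 2 ^ 4 = 4" "sqrt 2 ^ 5 = 4 * sqrt 2" "sqrt 2 ^ 6 = 8"
  by (simp_all add: eval_nat_numeral)

text \<open>The two neighbours at distance \<open>sqrt 2\<close> contribute
  \<open>1 + sqrt 2 / 2\<close> to the coefficient, and the opposite vertex at distance 2
  contributes \<open>1 / 2\<close>.\<close>

lemma manev_force_square_config:
  "manev_force square_config = - (((3 + sqrt 2) / 2) *\<^sub>R square_config)"
  by (rule config_eqI, simp only: atomize_all forall_4)
    (simp add: manev_force_def sum_Compl_singleton_4 pair_force_def vec_eq_iff
      forall_2 norm_vec_2 sqrt_2_powers field_simps flip: scaleR_minus_left)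

text \<open>The only distances in the square are the side \<open>sqrt 2\<close> and the diagonal
  2.\<close>

lemma pair_force_deriv_norm_eq:
  "norm d = sqrt 2 \<Longrightarrow>
    pair_force_deriv d h = (3 * sqrt 2 / 8 + 1) *\<^sub>R inner d h *\<^sub>R d - (sqrt 2 / 4 + 1 / 2) *\<^sub>R h"
  "norm d = 2 \<Longrightarrow> pair_force_deriv d h = (7 / 32) *\<^sub>R inner d h *\<^sub>R d - (1 / 4) *\<^sub>R h"
proof -
  have *: "3 / (4 * sqrt 2) = 3 * sqrt 2 / 8" "1 / (2 * sqrt 2) = sqrt 2 / 4"
    by (simp_all add: field_simps)
  show "pair_force_deriv d h =
      (3 * sqrt 2 / 8 + 1) *\<^sub>R inner d h *\<^sub>R d - (sqrt 2 / 4 + 1 / 2) *\<^sub>R h" if "norm d = sqrt 2"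
    unfolding pair_force_deriv_def that sqrt_2_powers * by simp
  show "pair_force_deriv d h = (7 / 32) *\<^sub>R inner d h *\<^sub>R d - (1 / 4) *\<^sub>R h" if "norm d = 2"
    unfolding pair_force_deriv_def that by simp
qed

text \<open>No mixing of \<open>a\<close> and \<open>b\<close> is to be expected: reflection in the
  first axis, with particles 2 and 4 exchanged, preserves the square and sends
  \<open>mode a b\<close> to \<open>mode a (- b)\<close>. The values come from a direct check of the
  eight coordinates.\<close>

lemma hessian_square_config_mode:
  "hessian manev_potential square_config *v mode a b =
     mode ((1 / 4 - sqrt 2 / 2) * a) ((5 / 2 + sqrt 2) * b)"
proof -
  let ?d = "\<lambda>i j. pos square_config i - pos square_config j"
  have norms:
    "norm (?d 1 2) = sqrt 2" "norm (?d 2 1) = sqrt 2" "norm (?d 2 3) = sqrt 2" "norm (?d 3 2) = sqrt 2"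
    "norm (?d 3 4) = sqrt 2" "norm (?d 4 3) = sqrt 2" "norm (?d 4 1) = sqrt 2" "norm (?d 1 4) = sqrt 2"
    "norm (?d 1 3) = 2" "norm (?d 3 1) = 2" "norm (?d 2 4) = 2" "norm (?d 4 2) = 2"
    by (simp_all add: norm_vec_2)
  have "(\<Sum>j\<in>-{i}. pair_force_deriv (?d i j) (pos (mode a b) i - pos (mode a b) j)) $ k =
      mode ((1 / 4 - sqrt 2 / 2) * a) ((5 / 2 + sqrt 2) * b) $ (i, k)" for i k
    using exhaust_4[of i] exhaust_2[of k]
    apply (elim disjE; hypsubst)
    apply (simp_all only: sum_Compl_singleton_4 norms pair_force_deriv_norm_eq mode_nth)
    apply (simp_all add: inner_vec_def sum_2 algebra_simps)
    done
  then show ?thesis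
    unfolding hessian_manev_potential[OF inj_pos_square_config]
    by (simp add: vec_prod_eq_iff)
qed

text \<open>\<open>J\<close> commutes with the planar rotations that build a mode, so it acts on the
  generating vector \<open>(a, b)\<close> alone.\<close>

lemma block_J_mult_mode: "map_matrix complex_of_real block_J *v mode a b = mode b (- a)"
proof -
  have sum_config: "sum f UNIV = (\<Sum>i\<in>UNIV. f (i, 1) + f (i, 2))" for f :: "4 \<times> 2 \<Rightarrow> complex"
    by (simp add: sum_2 sum.cartesian_product' flip: UNIV_Times_UNIV)
  show ?thesis
    by (simp add: vec_prod_eq_iff forall_4 forall_2 matrix_vector_mult_def map_matrix_def
        block_J_def J_def sum_config sum_4)
qed

section \<open>Angular velocity and instability of the square\<close>

theorem mainTheorem5:
  fixes \<omega> :: real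
  assumes "\<omega> > 0"
  shows "(relative_equilibrium manev_potential \<omega> square_config \<longleftrightarrow> \<omega>\<^sup>2 = (3 + sqrt 2) / 2) \<and>
         (relative_equilibrium manev_potential \<omega> square_config \<longrightarrow>
            linearly_unstable manev_potential \<omega> square_config)"
proof -
  \<comment> \<open>Lets the scalar coefficients of \<open>square_config\<close> be
    compared.\<close>
  have "square_config \<noteq> 0"
    using square_config_nth(1) by (metis zero_index zero_neq_one)
  then have iff: "relative_equilibrium manev_potential \<omega> square_config \<longleftrightarrow> \<omega>\<^sup>2 = (3 + sqrt 2) / 2"
    unfolding relative_equilibrium_manev_iff[OF inj_pos_square_config assms]
      manev_force_square_config by auto
  have "linearly_unstable manev_potential \<omega> square_config" if w: "\<omega>\<^sup>2 = (3 + sqrt 2) / 2"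
  proof -
    define k l where "k = (7 / 4 :: real)" and "l = 4 + 3 * sqrt 2 / 2"
    have kl: "k = \<omega>\<^sup>2 + (1 / 4 - sqrt 2 / 2)" "l = \<omega>\<^sup>2 + (5 / 2 + sqrt 2)"
      by (simp_all add: k_def l_def w field_simps)
    have "4 * \<omega>\<^sup>2 - k - l = 1 / 4 + sqrt 2 / 2"
      by (simp add: k_def l_def w field_simps)
    \<comment> \<open>Expanded, this reads
      \<open>9 / 16 + sqrt 2 / 4 < 28 + 21 * sqrt 2 / 2\<close>.\<close>
    moreover have "(1 / 4 + sqrt 2 / 2)\<^sup>2 < 4 * (k * l)"
      by (simp add: k_def l_def power2_eq_square algebra_simps)
        (use real_sqrt_ge_zero[of 2] in linarith)
    ultimately have "(4 * \<omega>\<^sup>2 - k - l)\<^sup>2 < 4 * (k * l)" by simp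
    then obtain \<mu> where \<mu>: "Re \<mu> > 0"
      "\<mu> ^ 4 + of_real (4 * \<omega>\<^sup>2 - k - l) * \<mu>\<^sup>2 + of_real (k * l) = 0"
      using exists_quartic_root_Re_pos by blast
    \<comment> \<open>Chosen to solve the first reduced equation identically; the second then
      becomes the characteristic equation of \<open>\<mu>\<close>, up to the factor
      \<open>2 * \<omega> * \<mu>\<close> cancelled on neither side of the first.\<close>
    define a b where "a = 2 * of_real \<omega> * \<mu>" and "b = \<mu>\<^sup>2 - of_real k"
    have "a \<noteq> 0" using \<mu>(1) assms by (auto simp: a_def)
    then have "mode a b \<noteq> 0" using mode_nth(1)[of a b] by (metis zero_index)
    have 1: "\<mu>\<^sup>2 * a = of_real k * a + 2 * of_real \<omega> * \<mu> * b"
      by (simp add: a_def b_def algebra_simps)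
    have 2: "\<mu>\<^sup>2 * b = of_real l * b - 2 * of_real \<omega> * \<mu> * a"
      using \<mu>(2) by (simp add: a_def b_def algebra_simps power2_eq_square power4_eq_xxxx)
    have hess: "map_matrix of_real (hessian manev_potential square_config) *v mode a b =
        mode (of_real (1 / 4 - sqrt 2 / 2) * a) (of_real (5 / 2 + sqrt 2) * b)"
      by (simp add: vec_eq_iff map_matrix_of_real_mult_vec complex_eq_iff mode_Re_Im
          hessian_square_config_mode)
    have "eigenvalue (map_matrix complex_of_real
        (linearization_matrix manev_potential \<omega> square_config)) \<mu>"
    proof (rule eigenvalue_linearization_matrixI[OF \<open>mode a b \<noteq> 0\<close>])
      show "\<mu>\<^sup>2 *s mode a b = of_real (\<omega>\<^sup>2) *s mode a b
          + map_matrix of_real (hessian manev_potential square_config) *v mode a b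
          + (2 * of_real \<omega> * \<mu>) *s (map_matrix of_real block_J *v mode a b)"
        unfolding hess block_J_mult_mode mode_linear 1 2
        by (simp add: kl algebra_simps)
    qed
    with \<mu>(1) show ?thesis
      unfolding linearly_unstable_def by blast
  qed
  with iff show ?thesis by blast
qed

end
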